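(* The following implications hold among the conditions (C1)–(C10) defined in the context: (C1) $\Rightarrow$ (C2); (C1) $\Rightarrow$ (C3); (C2) $\Rightarrow$ (C4); (C3) $\Rightarrow$ (C4); (C5) $\Rightarrow$ (C4); (C6) $\Rightarrow$ (C5); (C6) $\Rightarrow$ (C7); (C6) $\Rightarrow$ (C8); (C6) $\Rightarrow$ (C9); (C8) $\Rightarrow$ (C10); (C9) $\Rightarrow$ (C10).
   Context: Game. $\mathcal I=\{1,\dots,N\}$ is a set of agents; agent $i$ has strategy $x_i\in\mathcal X_i\subseteq\mathbb R^{n_i}$; $n=\sum_i n_i$, $\mathcal X=\mathcal X_1\times\dots\times\mathcal X_N\subseteq\mathbb R^n$, $x=\operatorname{col}((x_i)_{i\in\mathcal I})$ (stacked vector), $x_{-i}=\operatorname{col}((x_j)_{j\ne i})$. Agent $i$ has cost $f_i:\mathbb R^n\to\mathbb R$, written $f_i(x_i,x_{-i})$. A Nash equilibrium is $x^\star\in\mathcal X$ with $x_i^\star\in\operatorname{argmin}_{y\in\mathcal X_i}f_i(y,x_{-i}^\star)$ for all $i$. Standing assumptions. (Convexity) For each $i$, $\mathcal X_i$ is nonempty, closed and convex; $f_i$ is continuous and $f_i(\cdot,x_{-i})$ is convex for every $x_{-i}$. (Existence) The game has at least one Nash equilibrium. (Connectivity) $\mathcal G(\mathcal I,\mathcal E)$ is an undirected connected graph with weight matrix $W\in\mathbb R^{N\times N}$, $w_{i,j}=[W]_{i,j}$, where for $i\ne j$, $w_{i,j}>0$ if $(i,j)\in\mathcal E$ and $w_{i,j}=0$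 otherwise, and $W=W^\top$, $w_{i,i}>0$ for all $i$, $W\boldsymbol 1_N=\boldsymbol 1_N$, $\boldsymbol 1_N^\top W=\boldsymbol 1_N^\top$. Operators. $\partial_{x_i}f_i$ is the convex subdifferential with respect to the own strategy. The game mapping is $F:\mathbb R^n\rightrightarrows\mathbb R^n$, $F(x)=\operatorname{col}((\partial_{x_i}f_i(x_i,x_{-i}))_{i\in\mathcal I})$. For $\boldsymbol x=\operatorname{col}((\boldsymbol x_i)_{i\in\mathcal I})\in\mathbb R^{Nn}$ with $\boldsymbol x_i=\operatorname{col}((\boldsymbol x_{i,j})_{j\in\mathcal I})\in\mathbb R^n$, $\boldsymbol x_{i,j}\in\mathbb R^{n_j}$, $\boldsymbol x_{i,i}=x_i$, $\boldsymbol x_{i,-i}=\operatorname{col}((\boldsymbol x_{i,j})_{j\neq i})$, the extended game mapping is $\boldsymbol F(\boldsymbol x)=\operatorname{col}((\partial_{x_i}f_i(x_i,\boldsymbol x_{i,-i}))_{i\in\mathcal I})$. $\mathcal R_i\in\mathbb R^{n_i\times n}$ selects the $i$-th block of a vector in $\mathbb R^n$; $\mathcal R=\operatorname{diag}((\mathcal R_i)_{i})\in\mathbb R^{n\times Nn}$. With $\boldsymbol W=W\otimes I_n$, $\boldsymbol{\mathcal X}=\{\boldsymbol x\in\mathbb R^{Nn}\mid\mathcal R\boldsymbol x\in\mathcal X\}$ and $\alpha>0$, $$\mathcal F_\alpha(\boldsymbol x)=\alpha\mathcal R^\top\boldsymbol F(\boldsymbol x)+(I_{Nn}-\boldsymbol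 W)\boldsymbol x,\qquad \mathcal A_\alpha(\boldsymbol x)=\mathcal F_\alpha(\boldsymbol x)+\mathrm N_{\boldsymbol{\mathcal X}}(\boldsymbol x),$$ with $\mathrm N$ the normal cone (empty outside the set) and $\operatorname{zer}(\mathcal A_\alpha)=\{\boldsymbol x\mid0\in\mathcal A_\alpha(\boldsymbol x)\}$. A known fact: for every $\alpha>0$, $\operatorname{zer}(\mathcal A_\alpha)=\{\boldsymbol 1_N\otimes x^\star\mid x^\star\text{ is a Nash equilibrium}\}$ (in particular it is nonempty and independent of $\alpha>0$). Terminology. For $\mathcal F:\mathbb R^q\rightrightarrows\mathbb R^q$: monotone (strictly, $\mu$-strongly, $\nu$-hypomonotone) means $\langle u-v,x-y\rangle\ge0$ ($>0$ for $x\ne y$, $\ge\mu\|x-y\|^2$, $\ge-\nu\|x-y\|^2$) for all $(x,u),(y,v)$ in the graph; maximally monotone means monotone with graph not strictly contained in that of another monotone operator; restricted monotone ($\mu$-strongly) with respect to $\Sigma\neq\varnothing$ means $\langle x-x^\star,u-u^\star\rangle\ge0$ ($\ge\mu\|x-x^\star\|^2$) for all $(x,u),(x^\star,u^\star)$ in the graph with $x^\star\in\Sigma$. A single-valued $\mathcal F$ is $\ell$-Lipschitz if $\|\mathcal F(x)-\mathcal F(y)\|\le\ell\|x-y\|$; $\beta$-cocoercive if $\langle x-y,\mathcal F(x)-\mathcal F(y)\rangle\ge\beta\|\mathcal F(x)-\mathcal F(y)\|^2$; $R$-inverse Lipschitz if $R\|\mathcal F(x)-\mathcal F(y)\|\ge\|x-y\|$,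 for all $x,y$. (Being Lipschitz, cocoercive or inverse Lipschitz includes being single-valued.) Conditions. (C1) $\mathcal R^\top\boldsymbol F$ is maximally monotone. (C2) $\mathcal R^\top\boldsymbol F$ is restricted monotone with respect to $\operatorname{zer}(\mathcal A_\alpha)$. (C3) There exists $\alpha>0$ such that $\mathcal F_\alpha$ is maximally monotone. (C4) There exists $\alpha>0$ such that $\mathcal F_\alpha$ is restricted monotone with respect to $\operatorname{zer}(\mathcal A_\alpha)$. (C5) $F$ is $\mu$-restricted strongly monotone with respect to the set of Nash equilibria, and $\ell$-Lipschitz, for some $\mu>0$, $\ell>0$. (C6) $F$ is $\mu$-strongly monotone and $\ell$-Lipschitz, for some $\mu>0$, $\ell>0$. (C7) $F$ is $\nu$-hypomonotone, $\ell$-Lipschitz and $R$-inverse Lipschitz, for some $\nu\ge0$, $\ell>0$, $R>0$ with $R\nu<1$. (C8) $F$ is strictly monotone and $\ell$-Lipschitz, for some $\ell>0$. (C9) $F$ is $\frac1\ell$-cocoercive for some $\ell>0$. (C10) $F$ is monotone and $\ell$-Lipschitz, for some $\ell>0$. *)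

theory Defs
  imports "HOL-Analysis.Analysis"
begin

section \<open>Set-valued operators\<close>

definition op_graph :: "('a \<Rightarrow> 'b set) \<Rightarrow> ('a \<times> 'b) set" where
  "op_graph T = {(x, u). u \<in> T x}"

definition zer :: "('a \<Rightarrow> 'b::zero set) \<Rightarrow> 'a set" where
  "zer T = {x. 0 \<in> T x}"

definition monotone_op :: "('a::real_inner \<Rightarrow> 'a set) \<Rightarrow> bool" where
  "monotone_op T \<longleftrightarrow>
     (\<forall>(x, u) \<in> op_graph T. \<forall>(y, v) \<in> op_graph T. inner (u - v) (x - y) \<ge> 0)"

definition strictly_monotone_op :: "('a::real_inner \<Rightarrow> 'a set) \<Rightarrow> bool" where
  "strictly_monotone_op T \<longleftrightarrow>
     (\<forall>(x, u) \<in> op_graph T. \<forall>(y, v) \<in> op_graph T. x \<noteq> y \<longrightarrow> inner (u - v) (x - y) > 0)"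

definition strongly_monotone_op :: "real \<Rightarrow> ('a::real_inner \<Rightarrow> 'a set) \<Rightarrow> bool" where
  "strongly_monotone_op \<mu> T \<longleftrightarrow>
     (\<forall>(x, u) \<in> op_graph T. \<forall>(y, v) \<in> op_graph T.
        inner (u - v) (x - y) \<ge> \<mu> * (norm (x - y))\<^sup>2)"

definition hypomonotone_op :: "real \<Rightarrow> ('a::real_inner \<Rightarrow> 'a set) \<Rightarrow> bool" where
  "hypomonotone_op \<nu> T \<longleftrightarrow>
     (\<forall>(x, u) \<in> op_graph T. \<forall>(y, v) \<in> op_graph T.
        inner (u - v) (x - y) \<ge> - \<nu> * (norm (x - y))\<^sup>2)"

definition maximally_monotone_op :: "('a::real_inner \<Rightarrow> 'a set) \<Rightarrow> bool" where
  "maximally_monotone_op T \<longleftrightarrow>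
     monotone_op T \<and> \<not> (\<exists>S. monotone_op S \<and> op_graph T \<subset> op_graph S)"

definition restricted_monotone_op :: "'a set \<Rightarrow> ('a::real_inner \<Rightarrow> 'a set) \<Rightarrow> bool" where
  "restricted_monotone_op \<Sigma> T \<longleftrightarrow> \<Sigma> \<noteq> {} \<and>
     (\<forall>(x, u) \<in> op_graph T. \<forall>(y, v) \<in> op_graph T. y \<in> \<Sigma> \<longrightarrow> inner (x - y) (u - v) \<ge> 0)"

definition restricted_strongly_monotone_op ::
    "real \<Rightarrow> 'a set \<Rightarrow> ('a::real_inner \<Rightarrow> 'a set) \<Rightarrow> bool" where
  "restricted_strongly_monotone_op \<mu> \<Sigma> T \<longleftrightarrow> \<Sigma> \<noteq> {} \<and>
     (\<forall>(x, u) \<in> op_graph T. \<forall>(y, v) \<in> op_graph T.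
        y \<in> \<Sigma> \<longrightarrow> inner (x - y) (u - v) \<ge> \<mu> * (norm (x - y))\<^sup>2)"

text \<open>The next three properties include single-valuedness with full domain.\<close>

definition lipschitz_op :: "real \<Rightarrow> ('a::real_inner \<Rightarrow> 'a set) \<Rightarrow> bool" where
  "lipschitz_op l T \<longleftrightarrow> (\<exists>g. T = (\<lambda>x. {g x}) \<and> lipschitz_on l UNIV g)"

definition cocoercive_op :: "real \<Rightarrow> ('a::real_inner \<Rightarrow> 'a set) \<Rightarrow> bool" where
  "cocoercive_op \<beta> T \<longleftrightarrow>
     (\<exists>g. T = (\<lambda>x. {g x}) \<and>
       (\<forall>x y. inner (x - y) (g x - g y) \<ge> \<beta> * (norm (g x - g y))\<^sup>2))"

definition inverse_lipschitz_op :: "real \<Rightarrow> ('a::real_inner \<Rightarrow> 'a set) \<Rightarrow> bool" where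
  "inverse_lipschitz_op R T \<longleftrightarrow>
     (\<exists>g. T = (\<lambda>x. {g x}) \<and> (\<forall>x y. R * norm (g x - g y) \<ge> norm (x - y)))"

definition normal_cone :: "'a::real_inner set \<Rightarrow> 'a \<Rightarrow> 'a set" where
  "normal_cone S x = (if x \<in> S then {v. \<forall>y\<in>S. inner v (y - x) \<le> 0} else {})"

text \<open>Convex subdifferential at \<open>z \<in> V\<close> of a function on the Euclidean space \<open>V\<close>, where
  \<open>V\<close> is a linear subspace of the ambient type (subgradients are elements of \<open>V\<close>).\<close>

definition subdifferential :: "'a::real_inner set \<Rightarrow> ('a \<Rightarrow> real) \<Rightarrow> 'a \<Rightarrow> 'a set" where
  "subdifferential V h z = {g \<in> V. \<forall>y\<in>V. h y \<ge> h z + inner g (y - z)}"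

section \<open>Block vectors and games\<close>

text \<open>Agents are the elements of the finite type \<open>'i\<close>. The coordinates of the stacked strategy
  vector are the elements of the finite type \<open>'n\<close>, and \<open>owner c\<close> is the agent to whose block
  coordinate \<open>c\<close> belongs, so that the dimension of agent \<open>i\<close>'s strategy is
  \<open>card {c. owner c = i}\<close>. The strategy space of agent \<open>i\<close> is represented isometrically as
  the coordinate subspace of vectors supported on the block of \<open>i\<close>.\<close>

definition strategy_space :: "('n::finite \<Rightarrow> 'i::finite) \<Rightarrow> 'i \<Rightarrow> (real^'n) set" where
  "strategy_space owner i = {v. \<forall>c. owner c \<noteq> i \<longrightarrow> v $ c = 0}"

definition block :: "('n::finite \<Rightarrow> 'i::finite) \<Rightarrow> 'i \<Rightarrow> real^'n \<Rightarrow> real^'n" where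
  "block owner i x = (\<chi> c. if owner c = i then x $ c else 0)"

text \<open>The vector \<open>(y, x\<^sub>-\<^sub>i)\<close>: the block of \<open>i\<close> is taken from \<open>y\<close>, all others from \<open>x\<close>.\<close>

definition with_block :: "('n::finite \<Rightarrow> 'i::finite) \<Rightarrow> 'i \<Rightarrow> real^'n \<Rightarrow> real^'n \<Rightarrow> real^'n" where
  "with_block owner i y x = (\<chi> c. if owner c = i then y $ c else x $ c)"

definition joint_strategies ::
    "('n::finite \<Rightarrow> 'i::finite) \<Rightarrow> ('i \<Rightarrow> (real^'n) set) \<Rightarrow> (real^'n) set" where
  "joint_strategies owner X = {x. \<forall>i. block owner i x \<in> X i}"

definition nash_equilibria ::
    "('n::finite \<Rightarrow> 'i::finite) \<Rightarrow> ('i \<Rightarrow> (real^'n) set) \<Rightarrow> ('i \<Rightarrow> real^'n \<Rightarrow> real) \<Rightarrow> (real^'n) set"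
  where
  "nash_equilibria owner X f =
     {x \<in> joint_strategies owner X.
        \<forall>i. is_arg_min (\<lambda>y. f i (with_block owner i y x)) (\<lambda>y. y \<in> X i) (block owner i x)}"

definition partial_subdiff ::
    "('n::finite \<Rightarrow> 'i::finite) \<Rightarrow> ('i \<Rightarrow> real^'n \<Rightarrow> real) \<Rightarrow> 'i \<Rightarrow> real^'n \<Rightarrow> (real^'n) set" where
  "partial_subdiff owner f i x =
     subdifferential (strategy_space owner i) (\<lambda>y. f i (with_block owner i y x)) (block owner i x)"

definition game_map ::
    "('n::finite \<Rightarrow> 'i::finite) \<Rightarrow> ('i \<Rightarrow> real^'n \<Rightarrow> real) \<Rightarrow> real^'n \<Rightarrow> (real^'n) set" where
  "game_map owner f x = {u. \<forall>i. block owner i u \<in> partial_subdiff owner f i x}"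

section \<open>Estimates of all agents\<close>

text \<open>Vectors of dimension \<open>N n\<close> are indexed by \<open>'i \<times> 'n\<close>: entry \<open>(i, c)\<close> is agent \<open>i\<close>'s
  estimate of coordinate \<open>c\<close>.\<close>

definition estimate :: "real^('i::finite \<times> 'n::finite) \<Rightarrow> 'i \<Rightarrow> real^'n" where
  "estimate x i = (\<chi> c. x $ (i, c))"

text \<open>The own component of \<open>estimate x i\<close> is agent \<open>i\<close>'s actual strategy, so the argument of the
  \<open>i\<close>-th partial subdifferential below is the whole vector \<open>estimate x i\<close>.\<close>

definition extended_game_map ::
    "('n::finite \<Rightarrow> 'i::finite) \<Rightarrow> ('i \<Rightarrow> real^'n \<Rightarrow> real) \<Rightarrow> real^('i \<times> 'n) \<Rightarrow> (real^'n) set" where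
  "extended_game_map owner f x =
     {u. \<forall>i. block owner i u \<in> partial_subdiff owner f i (estimate x i)}"

text \<open>The block-diagonal matrix of the selection matrices: row \<open>c\<close> belongs to agent \<open>owner c\<close>
  and picks coordinate \<open>c\<close> out of that agent's own estimate.\<close>

definition selection_matrix :: "('n::finite \<Rightarrow> 'i::finite) \<Rightarrow> real^('i \<times> 'n)^'n" where
  "selection_matrix owner = (\<chi> c p. if p = (owner c, c) then 1 else 0)"

definition kronecker ::
    "real^'b::finite^'a::finite \<Rightarrow> real^'d::finite^'c::finite \<Rightarrow> real^('b \<times> 'd)^('a \<times> 'c)" where
  "kronecker A B = (\<chi> p q. A $ fst p $ fst q * B $ snd p $ snd q)"

definition extended_strategies ::
    "('n::finite \<Rightarrow> 'i::finite) \<Rightarrow> ('i \<Rightarrow> (real^'n) set) \<Rightarrow> (real^('i \<times> 'n)) set" where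
  "extended_strategies owner X = {x. selection_matrix owner *v x \<in> joint_strategies owner X}"

definition lifted_game_map ::
    "('n::finite \<Rightarrow> 'i::finite) \<Rightarrow> ('i \<Rightarrow> real^'n \<Rightarrow> real) \<Rightarrow> real^('i \<times> 'n) \<Rightarrow> (real^('i \<times> 'n)) set"
  where
  "lifted_game_map owner f x =
     (\<lambda>u. transpose (selection_matrix owner) *v u) ` extended_game_map owner f x"

definition F_alpha ::
    "('n::finite \<Rightarrow> 'i::finite) \<Rightarrow> ('i \<Rightarrow> real^'n \<Rightarrow> real) \<Rightarrow> real^'i^'i \<Rightarrow> real \<Rightarrow>
     real^('i \<times> 'n) \<Rightarrow> (real^('i \<times> 'n)) set" where
  "F_alpha owner f W \<alpha> x =
     {\<alpha> *\<^sub>R u + (mat 1 - kronecker W (mat 1)) *v x | u. u \<in> lifted_game_map owner f x}"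

definition A_alpha ::
    "('n::finite \<Rightarrow> 'i::finite) \<Rightarrow> ('i \<Rightarrow> (real^'n) set) \<Rightarrow> ('i \<Rightarrow> real^'n \<Rightarrow> real) \<Rightarrow>
     real^'i^'i \<Rightarrow> real \<Rightarrow> real^('i \<times> 'n) \<Rightarrow> (real^('i \<times> 'n)) set" where
  "A_alpha owner X f W \<alpha> x =
     {u + v | u v. u \<in> F_alpha owner f W \<alpha> x \<and> v \<in> normal_cone (extended_strategies owner X) x}"

section \<open>Standing assumptions\<close>

text \<open>Closedness and convexity in the coordinate subspace agree with closedness and convexity in
  the ambient space.\<close>

definition convex_game ::
    "('n::finite \<Rightarrow> 'i::finite) \<Rightarrow> ('i \<Rightarrow> (real^'n) set) \<Rightarrow> ('i \<Rightarrow> real^'n \<Rightarrow> real) \<Rightarrow> bool" where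
  "convex_game owner X f \<longleftrightarrow>
     (\<forall>i. X i \<subseteq> strategy_space owner i \<and> X i \<noteq> {} \<and> closed (X i) \<and> convex (X i) \<and>
          continuous_on UNIV (f i) \<and>
          (\<forall>x. convex_on (strategy_space owner i) (\<lambda>y. f i (with_block owner i y x))))"

definition connected_undirected_graph :: "('i \<times> 'i) set \<Rightarrow> bool" where
  "connected_undirected_graph E \<longleftrightarrow> sym E \<and> (\<forall>i j. (i, j) \<in> E\<^sup>*)"

definition graph_weight_matrix :: "('i::finite \<times> 'i) set \<Rightarrow> real^'i^'i \<Rightarrow> bool" where
  "graph_weight_matrix E W \<longleftrightarrow>
     (\<forall>i j. i \<noteq> j \<longrightarrow> (if (i, j) \<in> E then W $ i $ j > 0 else W $ i $ j = 0)) \<and>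
     W = transpose W \<and> (\<forall>i. W $ i $ i > 0) \<and> W *v 1 = 1 \<and> 1 v* W = 1"

section \<open>Monotonicity and regularity conditions\<close>

definition C1 :: "('n::finite \<Rightarrow> 'i::finite) \<Rightarrow> ('i \<Rightarrow> real^'n \<Rightarrow> real) \<Rightarrow> bool" where
  "C1 owner f \<longleftrightarrow> maximally_monotone_op (lifted_game_map owner f)"

text \<open>The zero set in the next condition does not depend on \<open>\<alpha> > 0\<close>; here \<open>\<alpha>\<close> is a
  parameter.\<close>

definition C2 :: "('n::finite \<Rightarrow> 'i::finite) \<Rightarrow> ('i \<Rightarrow> (real^'n) set) \<Rightarrow>
    ('i \<Rightarrow> real^'n \<Rightarrow> real) \<Rightarrow> real^'i^'i \<Rightarrow> real \<Rightarrow> bool" where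
  "C2 owner X f W \<alpha> \<longleftrightarrow>
     restricted_monotone_op (zer (A_alpha owner X f W \<alpha>)) (lifted_game_map owner f)"

definition C3 :: "('n::finite \<Rightarrow> 'i::finite) \<Rightarrow> ('i \<Rightarrow> real^'n \<Rightarrow> real) \<Rightarrow> real^'i^'i \<Rightarrow> bool" where
  "C3 owner f W \<longleftrightarrow> (\<exists>\<alpha>>0. maximally_monotone_op (F_alpha owner f W \<alpha>))"

definition C4 :: "('n::finite \<Rightarrow> 'i::finite) \<Rightarrow> ('i \<Rightarrow> (real^'n) set) \<Rightarrow>
    ('i \<Rightarrow> real^'n \<Rightarrow> real) \<Rightarrow> real^'i^'i \<Rightarrow> bool" where
  "C4 owner X f W \<longleftrightarrow>
     (\<exists>\<alpha>>0. restricted_monotone_op (zer (A_alpha owner X f W \<alpha>)) (F_alpha owner f W \<alpha>))"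

definition C5 :: "('n::finite \<Rightarrow> 'i::finite) \<Rightarrow> ('i \<Rightarrow> (real^'n) set) \<Rightarrow>
    ('i \<Rightarrow> real^'n \<Rightarrow> real) \<Rightarrow> bool" where
  "C5 owner X f \<longleftrightarrow>
     (\<exists>\<mu>>0. \<exists>l>0. restricted_strongly_monotone_op \<mu> (nash_equilibria owner X f) (game_map owner f) \<and>
        lipschitz_op l (game_map owner f))"

definition C6 :: "('n::finite \<Rightarrow> 'i::finite) \<Rightarrow> ('i \<Rightarrow> real^'n \<Rightarrow> real) \<Rightarrow> bool" where
  "C6 owner f \<longleftrightarrow>
     (\<exists>\<mu>>0. \<exists>l>0. strongly_monotone_op \<mu> (game_map owner f) \<and> lipschitz_op l (game_map owner f))"

definition C7 :: "('n::finite \<Rightarrow> 'i::finite) \<Rightarrow> ('i \<Rightarrow> real^'n \<Rightarrow> real) \<Rightarrow> bool" where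
  "C7 owner f \<longleftrightarrow>
     (\<exists>\<nu>\<ge>0. \<exists>l>0. \<exists>R>0. R * \<nu> < 1 \<and> hypomonotone_op \<nu> (game_map owner f) \<and>
        lipschitz_op l (game_map owner f) \<and> inverse_lipschitz_op R (game_map owner f))"

definition C8 :: "('n::finite \<Rightarrow> 'i::finite) \<Rightarrow> ('i \<Rightarrow> real^'n \<Rightarrow> real) \<Rightarrow> bool" where
  "C8 owner f \<longleftrightarrow>
     (\<exists>l>0. strictly_monotone_op (game_map owner f) \<and> lipschitz_op l (game_map owner f))"

definition C9 :: "('n::finite \<Rightarrow> 'i::finite) \<Rightarrow> ('i \<Rightarrow> real^'n \<Rightarrow> real) \<Rightarrow> bool" where
  "C9 owner f \<longleftrightarrow> (\<exists>l>0. cocoercive_op (1 / l) (game_map owner f))"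

definition C10 :: "('n::finite \<Rightarrow> 'i::finite) \<Rightarrow> ('i \<Rightarrow> real^'n \<Rightarrow> real) \<Rightarrow> bool" where
  "C10 owner f \<longleftrightarrow>
     (\<exists>l>0. monotone_op (game_map owner f) \<and> lipschitz_op l (game_map owner f))"

end

theory Submission
  imports Defs
begin

text \<open>The restricted conditions involve the nonempty set of zeros, so the known description of
  \<open>zer (A_alpha owner X f W \<alpha>)\<close> as the consensus vectors over Nash equilibria is needed; it rests on
  separating the strict epigraph of a cost from the strategy set at a minimizer. The same
  separation gives nonempty subdifferentials everywhere, hence (C1) speaks about an operator with
  full domain, for which adding the monotone linear Laplacian preserves maximality. For
  (C5) implies (C4), connectivity makes the Laplacian uniformly positive on the disagreement part,
  which for small \<open>\<alpha>\<close> dominates the cross terms controlled by the Lipschitz constant.\<close>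

section \<open>Separation and subgradients of convex functions\<close>

text \<open>The strict epigraph of \<open>h\<close> misses \<open>C\<close> times the half-line
  below \<open>h z\<close>, because \<open>z\<close> is a minimizer. One separating hyperplane
  yields both conclusions, so that a single \<open>g\<close> is a subgradient and satisfies the
  variational inequality on \<open>C\<close>.\<close>

lemma subgradient_at_constrained_minimizer:
  fixes h :: "'a::euclidean_space \<Rightarrow> real"
  assumes h: "convex_on UNIV h" and C: "convex C" and z: "z \<in> C"
    and min: "\<And>y. y \<in> C \<Longrightarrow> h z \<le> h y"
  obtains g where "\<And>y. h y \<ge> h z + inner g (y - z)" "\<And>y. y \<in> C \<Longrightarrow> inner g (y - z) \<ge> 0"
proof -
  define P where "P = {q :: 'a \<times> real. h (fst q) < snd q}"
  define Q where "Q = C \<times> {..h z}"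
  have "convex P"
    unfolding convex_alt
  proof (intro ballI allI impI)
    fix p q :: "'a \<times> real" and t :: real
    assume p: "p \<in> P" and q: "q \<in> P" and t: "0 \<le> t \<and> t \<le> 1"
    have "h ((1 - t) *\<^sub>R fst p + t *\<^sub>R fst q) \<le> (1 - t) * h (fst p) + t * h (fst q)"
      using convex_onD[OF h] t by auto
    also have "\<dots> < (1 - t) * snd p + t * snd q"
    proof (cases "t = 0")
      case False
      then have "t * h (fst q) < t * snd q" using q t by (simp add: P_def)
      moreover have "(1 - t) * h (fst p) \<le> (1 - t) * snd p"
        using p t by (intro mult_left_mono) (auto simp: P_def)
      ultimately show ?thesis by linarith
    qed (use p in \<open>simp add: P_def\<close>)
    finally show "(1 - t) *\<^sub>R p + t *\<^sub>R q \<in> P" by (simp add: P_def)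
  qed
  moreover have "convex Q" unfolding Q_def using C by (intro convex_Times) auto
  moreover have "(z, h z + 1) \<in> P" "(z, h z) \<in> Q" using z by (auto simp: P_def Q_def)
  moreover have "P \<inter> Q = {}" using min by (force simp: P_def Q_def)
  ultimately obtain a b where a0: "a \<noteq> 0" and aP: "\<forall>q\<in>P. inner a q \<le> b" and aQ: "\<forall>q\<in>Q. inner a q \<ge> b"
    using separating_hyperplane_sets[of P Q] by blast
  obtain p s where a: "a = (p, s)" by (cases a)
  have PQ: "inner p y + s * t \<le> inner p w + s * h z" if "h y < t" "w \<in> C" for y t w
  proof -
    have "inner a (y, t) \<le> b" using aP that by (auto simp: P_def)
    also have "b \<le> inner a (w, h z)" using aQ that by (auto simp: Q_def)
    finally show ?thesis by (simp add: a)
  qed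
  have "s * 1 \<le> 0" using PQ[of z "h z + 1" z] z by (simp add: algebra_simps)
  \<comment> \<open>A vertical hyperplane is impossible: the epigraph lies over the whole space, so
    it may be tested above \<open>z + p\<close>.\<close>
  moreover have "s \<noteq> 0"
  proof
    assume s: "s = 0"
    have "inner p (z + p) \<le> inner p z" using PQ[of "z + p" "h (z + p) + 1" z] z s by simp
    then have "inner p p \<le> 0" by (simp add: inner_add_right)
    then have "p = 0" using inner_ge_zero[of p] by (metis antisym inner_eq_zero_iff)
    then show False using a0 a s by (simp add: zero_prod_def)
  qed
  ultimately have s: "s < 0" by simp
  \<comment> \<open>Heights in the strict epigraph come arbitrarily close to \<open>h y\<close>.
    Keeping \<open>w\<close> free in \<open>C\<close> serves twice: \<open>w = z\<close> is the
    subgradient inequality, \<open>y = z\<close> the variational one.\<close>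
  have main: "h y \<ge> h z + inner ((1 / (- s)) *\<^sub>R p) (y - w)" if w: "w \<in> C" for y w
  proof -
    have "h y \<ge> (inner p (y - w) + (- s) * h z) / (- s)"
    proof (rule field_le_epsilon)
      fix e :: real assume "e > 0"
      then have "inner p y + s * (h y + e) \<le> inner p w + s * h z" using PQ[of y "h y + e" w] w by simp
      then have "inner p (y - w) + (- s) * h z \<le> (h y + e) * (- s)"
        by (simp add: inner_diff_right algebra_simps)
      then show "(inner p (y - w) + (- s) * h z) / (- s) \<le> h y + e"
        using s by (subst pos_divide_le_eq) auto
    qed
    then show ?thesis using s by (simp add: field_simps)
  qed
  show ?thesis
  proof (rule that[of "(1 / (- s)) *\<^sub>R p"])
    show "h y \<ge> h z + inner ((1 / (- s)) *\<^sub>R p) (y - z)" for y using main[OF z] .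
    show "inner ((1 / (- s)) *\<^sub>R p) (y - z) \<ge> 0" if "y \<in> C" for y
      using main[OF that, of z] by (simp add: inner_diff_right)
  qed
qed

section \<open>Maximal monotonicity\<close>

text \<open>A pair monotonically related to the whole graph can be adjoined without losing
  monotonicity, so maximality puts it into the graph; conversely, every pair of a monotone extension
  is related in this way. Quantification over operators thus becomes a test on pairs.\<close>

lemma maximally_monotone_op_iff:
  "maximally_monotone_op T \<longleftrightarrow> monotone_op T \<and>
     (\<forall>x u. (\<forall>y v. v \<in> T y \<longrightarrow> inner (u - v) (x - y) \<ge> 0) \<longrightarrow> u \<in> T x)"
proof (intro iffI conjI allI impI)
  assume T: "maximally_monotone_op T"
  then show "monotone_op T" by (simp add: maximally_monotone_op_def)
  fix x u assume xu: "\<forall>y v. v \<in> T y \<longrightarrow> inner (u - v) (x - y) \<ge> 0"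
  show "u \<in> T x"
  proof (rule ccontr)
    assume "u \<notin> T x"
    define S where "S = T(x := insert u (T x))"
    have flip: "inner (v - u) (y - x) = inner (u - v) (x - y)" for y v
      by (metis inner_minus_left inner_minus_right minus_diff_eq minus_minus)
    have "inner (v - w) (y - y') \<ge> 0" if "v \<in> S y" "w \<in> S y'" for v w y y'
    proof -
      have "v \<in> T y \<or> (y = x \<and> v = u)" "w \<in> T y' \<or> (y' = x \<and> w = u)"
        using that by (auto simp: S_def split: if_splits)
      moreover have "inner (v - w) (y - y') \<ge> 0" if "v \<in> T y" "w \<in> T y'"
        using T that by (auto simp: maximally_monotone_op_def monotone_op_def op_graph_def)
      ultimately show ?thesis using xu flip by force
    qed
    then have "monotone_op S" by (auto simp: monotone_op_def op_graph_def)
    moreover have "op_graph T \<subset> op_graph S"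
    proof
      show "op_graph T \<subseteq> op_graph S" by (auto simp: op_graph_def S_def)
      have "(x, u) \<in> op_graph S" "(x, u) \<notin> op_graph T"
        using \<open>u \<notin> T x\<close> by (auto simp: op_graph_def S_def)
      then show "op_graph T \<noteq> op_graph S" by blast
    qed
    ultimately show False using T by (auto simp: maximally_monotone_op_def)
  qed
next
  assume T: "monotone_op T \<and>
     (\<forall>x u. (\<forall>y v. v \<in> T y \<longrightarrow> inner (u - v) (x - y) \<ge> 0) \<longrightarrow> u \<in> T x)"
  have "op_graph S \<subseteq> op_graph T" if "monotone_op S" "op_graph T \<subseteq> op_graph S" for S
  proof clarify
    fix x u assume "(x, u) \<in> op_graph S"
    then have "\<forall>y v. v \<in> T y \<longrightarrow> inner (u - v) (x - y) \<ge> 0"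
      using that by (fastforce simp: monotone_op_def op_graph_def)
    then show "(x, u) \<in> op_graph T" using T by (auto simp: op_graph_def)
  qed
  then show "maximally_monotone_op T" using T by (auto simp: maximally_monotone_op_def)
qed

text \<open>A pair \<open>(x, u)\<close> related to the sum is tested against the points \<open>x + t d\<close>, \<open>t \<rightarrow> 0\<close>, of the
  segment to a given \<open>y = x + d\<close>; there the contribution of \<open>B\<close> is of second order in \<open>t\<close>.\<close>

lemma maximally_monotone_op_add_linear:
  fixes T :: "'a::real_inner \<Rightarrow> 'a set"
  assumes T: "maximally_monotone_op T" and dom: "\<And>x. T x \<noteq> {}"
    and B: "linear B" and pos: "\<And>x. inner (B x) x \<ge> 0"
  shows "maximally_monotone_op (\<lambda>x. {u + B x | u. u \<in> T x})"
proof -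
  have monoT: "inner (u - v) (x - y) \<ge> 0" if "u \<in> T x" "v \<in> T y" for u v x y
    using T that by (auto simp: maximally_monotone_op_def monotone_op_def op_graph_def)
  have maxT: "u \<in> T x" if "\<And>y v. v \<in> T y \<Longrightarrow> inner (u - v) (x - y) \<ge> 0" for x u
    using T that by (auto simp: maximally_monotone_op_iff)
  have "inner (u + B x - (v + B y)) (x - y) \<ge> 0" if "u \<in> T x" "v \<in> T y" for u v x y
  proof -
    have "inner (u + B x - (v + B y)) (x - y) = inner (u - v) (x - y) + inner (B (x - y)) (x - y)"
      by (simp add: linear_diff[OF B] algebra_simps)
    then show ?thesis using monoT[OF that] pos[of "x - y"] by simp
  qed
  moreover have "\<exists>u'\<in>T x. u = u' + B x"
    if rel: "\<And>y v. v \<in> T y \<Longrightarrow> inner (u - (v + B y)) (x - y) \<ge> 0" for x u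
  proof -
    have "u - B x \<in> T x"
    proof (rule maxT)
      fix y v assume v: "v \<in> T y"
      define d where "d = y - x"
      \<comment> \<open>By \<open>dom\<close> some \<open>w\<close> exists at the intermediate
        point, and it drops out: monotonicity against \<open>v\<close> bounds
        \<open>inner w d\<close> from above, \<open>rel\<close> bounds it from below.\<close>
      have est: "- t * inner (B d) d \<le> inner (v - (u - B x)) d" if t: "0 < t" "t < 1" for t
      proof -
        obtain w where w: "w \<in> T (x + t *\<^sub>R d)" using dom by blast
        have "inner (v - w) (y - (x + t *\<^sub>R d)) \<ge> 0" using monoT[OF v w] .
        moreover have "y - (x + t *\<^sub>R d) = (1 - t) *\<^sub>R d" by (simp add: d_def algebra_simps)
        ultimately have vw: "inner (v - w) d \<ge> 0" using t by (simp add: zero_le_mult_iff)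
        have "inner (u - (w + B (x + t *\<^sub>R d))) (- (t *\<^sub>R d)) \<ge> 0"
          using rel[OF w] by simp
        then have "t * inner (w + B (x + t *\<^sub>R d) - u) d \<ge> 0"
          by (simp add: inner_diff_left algebra_simps)
        then have "inner (w + B (x + t *\<^sub>R d) - u) d \<ge> 0" using t by (simp add: zero_le_mult_iff)
        then have "inner (w - (u - B x)) d + t * inner (B d) d \<ge> 0"
          by (simp add: linear_add[OF B] linear_scale[OF B] algebra_simps)
        then show ?thesis using vw by (simp add: inner_diff_left)
      qed
      have "((\<lambda>t. - t * inner (B d) d) \<longlongrightarrow> - 0 * inner (B d) d) (at_right 0)"
        by (intro tendsto_intros)
      moreover have "\<forall>\<^sub>F t in at_right (0::real). - t * inner (B d) d \<le> inner (v - (u - B x)) d"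
        unfolding eventually_at_right_field by (intro exI[of _ 1]) (use est in auto)
      ultimately have "- 0 * inner (B d) d \<le> inner (v - (u - B x)) d"
        using tendsto_upperbound trivial_limit_at_right_real by blast
      then show "inner (u - B x - v) (x - y) \<ge> 0"
        by (simp add: d_def algebra_simps inner_diff_left inner_diff_right)
    qed
    then show ?thesis by (intro bexI[of _ "u - B x"]) auto
  qed
  ultimately show ?thesis
    unfolding maximally_monotone_op_iff monotone_op_def op_graph_def by (auto; metis)
qed

lemma restricted_monotone_op_if_monotone_op:
  "\<lbrakk>monotone_op T; \<Sigma> \<noteq> {}\<rbrakk> \<Longrightarrow> restricted_monotone_op \<Sigma> T"
  by (auto simp: monotone_op_def restricted_monotone_op_def inner_commute)

section \<open>Block vectors, selection matrix and consensus vectors\<close>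

text \<open>The default rule rewrites \<open>transpose A *v u\<close> to \<open>u v* A\<close>,
  which would keep the componentwise rule for the transposed selection matrix from matching.\<close>

declare transpose_matrix_vector [simp del]

lemma selection_matrix_mult_nth [simp]: "(selection_matrix owner *v x) $ c = x $ (owner c, c)"
proof -
  have "(selection_matrix owner *v x) $ c = (\<Sum>p\<in>UNIV. if p = (owner c, c) then x $ p else 0)"
    unfolding matrix_vector_mult_def selection_matrix_def vec_lambda_beta
    by (intro sum.cong) auto
  then show ?thesis by simp
qed

lemma transpose_selection_matrix_mult_nth [simp]:
  "(transpose (selection_matrix owner) *v u) $ (i, c) = (if owner c = i then u $ c else 0)"
proof -
  have "(transpose (selection_matrix owner) *v u) $ (i, c) =
      (\<Sum>c'\<in>UNIV. if c' = c then (if owner c = i then u $ c else 0) else 0)"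
    unfolding matrix_vector_mult_def selection_matrix_def transpose_def vec_lambda_beta
    by (intro sum.cong) auto
  then show ?thesis by simp
qed

lemma inner_transpose_mult: "inner (transpose A *v u) x = inner u (A *v x)"
  for A :: "real^'m^'n"
  by (simp add: transpose_matrix_vector dot_lmul_matrix)

text \<open>The Kronecker product of the all-ones vector with \<open>y\<close>: every agent holds
  the estimate \<open>y\<close>.\<close>

definition consensus :: "real^'n::finite \<Rightarrow> real^('i::finite \<times> 'n)" where
  "consensus y = (\<chi> p. y $ snd p)"

lemma consensus_nth [simp]: "consensus y $ p = y $ snd p"
  by (simp add: consensus_def)

lemma estimate_nth [simp]: "estimate x i $ c = x $ (i, c)"
  by (simp add: estimate_def)

lemma estimate_consensus [simp]: "estimate (consensus y) i = y"
  by (simp add: vec_eq_iff)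

lemma selection_matrix_consensus [simp]: "selection_matrix owner *v consensus y = y"
  by (simp add: vec_eq_iff)

lemma block_nth [simp]: "block owner i x $ c = (if owner c = i then x $ c else 0)"
  by (simp add: block_def)

lemma block_in_strategy_space [simp]: "block owner i x \<in> strategy_space owner i"
  by (simp add: strategy_space_def)

lemma block_diff: "block owner i (x - y) = block owner i x - block owner i y"
  by (simp add: vec_eq_iff)

lemma inner_block: "inner (block owner i x) y = inner (block owner i x) (block owner i y)"
  by (auto simp: inner_vec_def intro!: sum.cong)

lemma inner_block_left: "y \<in> strategy_space owner i \<Longrightarrow> inner (block owner i x) y = inner x y"
  by (auto simp: inner_vec_def strategy_space_def intro!: sum.cong)

lemma sum_inner_block: "(\<Sum>i\<in>UNIV. inner (block owner i x) y) = inner x y"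
proof -
  have "(\<Sum>i\<in>UNIV. inner (block owner i x) y) =
      (\<Sum>c\<in>UNIV. \<Sum>i\<in>UNIV. if owner c = i then x $ c * y $ c else 0)"
    unfolding inner_vec_def by (subst sum.swap) (auto intro!: sum.cong)
  then show ?thesis by (simp add: inner_vec_def)
qed

lemma with_block_block: "with_block owner i (block owner i y) x = with_block owner i y x"
  by (simp add: with_block_def vec_eq_iff)

lemma inner_estimates: "inner x y = (\<Sum>i\<in>UNIV. inner (estimate x i) (estimate y i))"
  unfolding inner_vec_def by (simp add: sum.cartesian_product flip: UNIV_Times_UNIV)

text \<open>Of all agents' copies of a coordinate only the owner's is kept, so the sum of squares
  can only shrink.\<close>

lemma norm_selection_matrix_mult_le: "norm (selection_matrix owner *v x) \<le> norm x"
proof -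
  have "inner (selection_matrix owner *v x) (selection_matrix owner *v x) \<le>
      (\<Sum>c\<in>UNIV. \<Sum>i\<in>UNIV. x $ (i, c) * x $ (i, c))"
    unfolding inner_vec_def
    by (auto intro!: sum_mono member_le_sum[where f = "\<lambda>i. x $ (i, c) * x $ (i, c)" for c, simplified])
  also have "\<dots> = inner x x" unfolding inner_estimates
    by (subst sum.swap) (simp add: inner_vec_def)
  finally show ?thesis by (simp add: norm_eq_sqrt_inner)
qed

section \<open>Partial subdifferentials and Nash equilibria\<close>

text \<open>\<open>with_block\<close> ignores the coordinates of \<open>y\<close> outside the block,
  so convexity extends from the strategy subspace to the ambient space, where separation takes
  place.\<close>

lemma convex_on_own_strategy:
  assumes "convex_game owner X f"
  shows "convex_on UNIV (\<lambda>y. f i (with_block owner i y x))"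
proof (rule convex_onI)
  fix t :: real and y y' assume t: "0 < t" "t < 1"
  let ?h = "\<lambda>y. f i (with_block owner i y x)"
  have "convex_on (strategy_space owner i) ?h" using assms by (simp add: convex_game_def)
  from convex_onD[OF this, of t "block owner i y" "block owner i y'"] t
  have "?h ((1 - t) *\<^sub>R block owner i y + t *\<^sub>R block owner i y') \<le> (1 - t) * ?h y + t * ?h y'"
    by (simp add: with_block_block)
  moreover have "(1 - t) *\<^sub>R block owner i y + t *\<^sub>R block owner i y' =
      block owner i ((1 - t) *\<^sub>R y + t *\<^sub>R y')" by (simp add: vec_eq_iff)
  ultimately show "?h ((1 - t) *\<^sub>R y + t *\<^sub>R y') \<le> (1 - t) * ?h y + t * ?h y'"
    by (simp add: with_block_block)
qed simp

text \<open>Separation gives a subgradient in the ambient space. Its block for \<open>i\<close> has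
  the same inner products with differences inside the strategy subspace, hence keeps both
  inequalities.\<close>

lemma partial_subgradient_at_constrained_minimizer:
  assumes game: "convex_game owner X f" and C: "convex C" "C \<subseteq> strategy_space owner i"
    and x: "block owner i x \<in> C"
    and min: "\<And>y. y \<in> C \<Longrightarrow> f i (with_block owner i (block owner i x) x) \<le> f i (with_block owner i y x)"
  obtains g where "g \<in> partial_subdiff owner f i x"
    and "\<And>y. y \<in> C \<Longrightarrow> inner g (y - block owner i x) \<ge> 0"
proof -
  let ?h = "\<lambda>y. f i (with_block owner i y x)"
  obtain g where g: "\<And>y. ?h y \<ge> ?h (block owner i x) + inner g (y - block owner i x)"
    and gC: "\<And>y. y \<in> C \<Longrightarrow> inner g (y - block owner i x) \<ge> 0"
    using subgradient_at_constrained_minimizer[OF convex_on_own_strategy[OF game] C(1) x min] by blast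
  have proj: "inner (block owner i g) (y - block owner i x) = inner g (y - block owner i x)"
    if "y \<in> strategy_space owner i" for y
    using that by (intro inner_block_left) (auto simp: strategy_space_def)
  show ?thesis
  proof (rule that[of "block owner i g"])
    show "block owner i g \<in> partial_subdiff owner f i x"
      using g by (simp add: partial_subdiff_def subdifferential_def proj)
    show "inner (block owner i g) (y - block owner i x) \<ge> 0" if "y \<in> C" for y
      using gC[OF that] proj C(2) that by auto
  qed
qed

lemma partial_subdiff_subset: "partial_subdiff owner f i x \<subseteq> strategy_space owner i"
  by (auto simp: partial_subdiff_def subdifferential_def)

text \<open>Every point is a minimizer over the singleton containing it, so the constrained result
  applies everywhere.\<close>

lemma partial_subdiff_nonempty:
  assumes "convex_game owner X f"
  shows "partial_subdiff owner f i x \<noteq> {}"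
proof -
  obtain g where "g \<in> partial_subdiff owner f i x"
    by (rule partial_subgradient_at_constrained_minimizer[OF assms, of "{block owner i x}" i x]) auto
  then show ?thesis by blast
qed

text \<open>The supports are disjoint, so the blocks glue together: coordinate \<open>c\<close> is
  read off the vector of its owner.\<close>

lemma stack_blocks:
  assumes "\<And>i. G i \<in> strategy_space owner i"
  obtains u where "\<And>i. block owner i u = G i"
proof
  show "block owner i (\<chi> c. G (owner c) $ c) = G i" for i
    using assms[of i] by (auto simp: vec_eq_iff strategy_space_def)
qed

lemma extended_game_map_nonempty:
  assumes "convex_game owner X f"
  shows "extended_game_map owner f x \<noteq> {}"
proof -
  define G where "G i = (SOME g. g \<in> partial_subdiff owner f i (estimate x i))" for i
  have G: "G i \<in> partial_subdiff owner f i (estimate x i)" for i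
    unfolding G_def some_in_eq using partial_subdiff_nonempty[OF assms] .
  then have "G i \<in> strategy_space owner i" for i using partial_subdiff_subset by blast
  then obtain u where "\<And>i. block owner i u = G i" using stack_blocks[of G owner] by blast
  then have "u \<in> extended_game_map owner f x" using G by (simp add: extended_game_map_def)
  then show ?thesis by blast
qed

text \<open>First-order optimality of each agent, merged into one variational inequality over the
  product set: summing over the agents gives one direction, unilateral deviations the other.\<close>

lemma nash_equilibria_iff:
  assumes "convex_game owner X f"
  shows "y \<in> nash_equilibria owner X f \<longleftrightarrow> y \<in> joint_strategies owner X \<and>
    (\<exists>u. (\<forall>i. block owner i u \<in> partial_subdiff owner f i y) \<and>
       (\<forall>y'\<in>joint_strategies owner X. inner u (y' - y) \<ge> 0))"
proof (intro iffI conjI; (elim conjE exE)?)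
  assume y: "y \<in> nash_equilibria owner X f"
  then show yX: "y \<in> joint_strategies owner X" by (simp add: nash_equilibria_def)
  have X: "convex (X i)" "X i \<subseteq> strategy_space owner i" "block owner i y \<in> X i" for i
    using assms yX by (auto simp: convex_game_def joint_strategies_def)
  have "\<exists>g. g \<in> partial_subdiff owner f i y \<and> (\<forall>y'\<in>X i. inner g (y' - block owner i y) \<ge> 0)" for i
  proof -
    have "f i (with_block owner i (block owner i y) y) \<le> f i (with_block owner i y' y)"
      if "y' \<in> X i" for y'
      using y that by (auto simp: nash_equilibria_def is_arg_min_linorder)
    then show ?thesis
      using partial_subgradient_at_constrained_minimizer[OF assms X(1,2,3)] by metis
  qed
  then obtain G where G: "\<And>i. G i \<in> partial_subdiff owner f i y"
    "\<And>i y'. y' \<in> X i \<Longrightarrow> inner (G i) (y' - block owner i y) \<ge> 0" by metis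
  then have "G i \<in> strategy_space owner i" for i using partial_subdiff_subset by blast
  then obtain u where u: "\<And>i. block owner i u = G i" using stack_blocks[of G owner] by blast
  have "inner u (y' - y) \<ge> 0" if "y' \<in> joint_strategies owner X" for y'
  proof -
    have "inner u (y' - y) = (\<Sum>i\<in>UNIV. inner (block owner i u) (y' - y))" by (simp add: sum_inner_block)
    also have "\<dots> = (\<Sum>i\<in>UNIV. inner (G i) (block owner i y' - block owner i y))"
      by (metis inner_block u block_diff)
    also have "\<dots> \<ge> 0" using G(2) that by (auto simp: joint_strategies_def intro!: sum_nonneg)
    finally show ?thesis .
  qed
  then show "\<exists>u. (\<forall>i. block owner i u \<in> partial_subdiff owner f i y) \<and>
       (\<forall>y'\<in>joint_strategies owner X. inner u (y' - y) \<ge> 0)" using u G by metis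
next
  fix u assume yX: "y \<in> joint_strategies owner X"
    and u: "\<forall>i. block owner i u \<in> partial_subdiff owner f i y"
    and uX: "\<forall>y'\<in>joint_strategies owner X. inner u (y' - y) \<ge> 0"
  have "f i (with_block owner i (block owner i y) y) \<le> f i (with_block owner i z y)"
    if z: "z \<in> X i" for i z
  proof -
    have zV: "z \<in> strategy_space owner i" using assms z by (auto simp: convex_game_def)
    \<comment> \<open>Only agent \<open>i\<close> deviates, so \<open>y' - y\<close> lives on one
      block and the joint inequality becomes the optimality condition of \<open>i\<close>.\<close>
    define y' where "y' = with_block owner i z y"
    have "block owner j y' = (if j = i then z else block owner j y)" for j
      using zV by (auto simp: y'_def with_block_def vec_eq_iff strategy_space_def)
    then have "y' \<in> joint_strategies owner X" using yX z by (simp add: joint_strategies_def)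
    then have "0 \<le> inner u (y' - y)" using uX by blast
    also have "y' - y = z - block owner i y"
      using zV by (auto simp: y'_def with_block_def vec_eq_iff strategy_space_def)
    also have "inner u (z - block owner i y) = inner (block owner i u) (z - block owner i y)"
      using zV by (intro inner_block_left[symmetric]) (auto simp: strategy_space_def)
    finally show ?thesis
      using u zV by (fastforce simp: partial_subdiff_def subdifferential_def)
  qed
  then show "y \<in> nash_equilibria owner X f"
    using yX by (auto simp: nash_equilibria_def is_arg_min_linorder joint_strategies_def)
qed

section \<open>Weight matrix and spectral gap of the Laplacian\<close>

lemma graph_weight_matrix_nonneg: "graph_weight_matrix E W \<Longrightarrow> W $ i $ j \<ge> 0"
  by (cases "i = j"; cases "(i, j) \<in> E") (auto simp: graph_weight_matrix_def less_imp_le)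

lemma graph_weight_matrix_sym: "graph_weight_matrix E W \<Longrightarrow> W $ i $ j = W $ j $ i"
  unfolding graph_weight_matrix_def transpose_def by (metis vec_lambda_beta)

lemma graph_weight_matrix_row_sum:
  assumes "graph_weight_matrix E W"
  shows "(\<Sum>j\<in>UNIV. W $ i $ j) = 1"
proof -
  have "(W *v 1) $ i = 1" using assms by (simp add: graph_weight_matrix_def)
  then show ?thesis by (simp add: matrix_vector_mult_def)
qed

text \<open>In the expanded square both pure terms reduce to the plain sum of squares, by unit row
  sums and symmetry. The factor one half compensates for counting each pair of agents in both
  orders.\<close>

lemma dirichlet_form:
  fixes t :: "'i::finite \<Rightarrow> real"
  assumes "graph_weight_matrix E W"
  shows "(\<Sum>i\<in>UNIV. (t i - (\<Sum>j\<in>UNIV. W $ i $ j * t j)) * t i) =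
    (\<Sum>i\<in>UNIV. \<Sum>j\<in>UNIV. W $ i $ j * (t i - t j)\<^sup>2) / 2"
proof -
  note row = graph_weight_matrix_row_sum[OF assms]
  have 1: "(\<Sum>i\<in>UNIV. \<Sum>j\<in>UNIV. W $ i $ j * (t i)\<^sup>2) = (\<Sum>i\<in>UNIV. (t i)\<^sup>2)"
    by (simp add: row flip: sum_distrib_right)
  have 2: "(\<Sum>i\<in>UNIV. \<Sum>j\<in>UNIV. W $ i $ j * (t j)\<^sup>2) = (\<Sum>i\<in>UNIV. (t i)\<^sup>2)"
    by (subst sum.swap, subst graph_weight_matrix_sym[OF assms]) (rule 1)
  have "(\<Sum>i\<in>UNIV. \<Sum>j\<in>UNIV. W $ i $ j * (t i - t j)\<^sup>2) =
      (\<Sum>i\<in>UNIV. \<Sum>j\<in>UNIV. W $ i $ j * (t i)\<^sup>2) + (\<Sum>i\<in>UNIV. \<Sum>j\<in>UNIV. W $ i $ j * (t j)\<^sup>2)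
      - 2 * (\<Sum>i\<in>UNIV. \<Sum>j\<in>UNIV. W $ i $ j * t j * t i)"
    by (simp add: power2_diff sum_distrib_left algebra_simps sum.distrib sum_subtractf)
  moreover have "(\<Sum>i\<in>UNIV. (t i - (\<Sum>j\<in>UNIV. W $ i $ j * t j)) * t i) =
      (\<Sum>i\<in>UNIV. (t i)\<^sup>2) - (\<Sum>i\<in>UNIV. \<Sum>j\<in>UNIV. W $ i $ j * t j * t i)"
    by (simp add: left_diff_distrib sum_subtractf sum_distrib_right power2_eq_square)
  ultimately show ?thesis unfolding 1 2 by simp
qed

text \<open>If the form vanishes, \<open>t\<close> agrees across edges, hence is constant by
  connectivity, hence zero by the sum condition. So the form is positive on the compact set
  \<open>S\<close>, its minimum there is \<open>lam\<close>, and homogeneity of degree two does the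
  rest.\<close>

lemma dirichlet_form_gap:
  fixes W :: "real^'i::finite^'i"
  assumes E: "connected_undirected_graph E" and W: "graph_weight_matrix E W"
  obtains lam where "lam > 0" and "\<And>t :: real^'i. (\<Sum>i\<in>UNIV. t $ i) = 0 \<Longrightarrow>
    lam * (norm t)\<^sup>2 \<le> (\<Sum>i\<in>UNIV. \<Sum>j\<in>UNIV. W $ i $ j * (t $ i - t $ j)\<^sup>2)"
proof -
  define D where "D t = (\<Sum>i\<in>UNIV. \<Sum>j\<in>UNIV. W $ i $ j * (t $ i - t $ j)\<^sup>2)" for t :: "real^'i"
  define S where "S = sphere 0 1 \<inter> {t :: real^'i. (\<Sum>i\<in>UNIV. t $ i) = 0}"
  note nonneg = graph_weight_matrix_nonneg[OF W]
  have D0: "D t \<ge> 0" for t unfolding D_def by (intro sum_nonneg mult_nonneg_nonneg nonneg) auto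
  have pos: "D t > 0" if t: "t \<in> S" for t
  proof (rule ccontr)
    assume "\<not> D t > 0"
    then have "D t = 0" using D0[of t] by linarith
    then have "W $ i $ j * (t $ i - t $ j)\<^sup>2 = 0" for i j
      unfolding D_def by (simp add: sum_nonneg_eq_0_iff sum_nonneg nonneg)
    then have edge: "t $ i = t $ j" if "(i, j) \<in> E" for i j
      using that W by (cases "i = j") (force simp: graph_weight_matrix_def)+
    have const: "t $ i = t $ j" for i j
    proof -
      have "(i, j) \<in> E\<^sup>*" using E by (simp add: connected_undirected_graph_def)
      then show ?thesis by induction (auto dest: edge)
    qed
    have "t $ i = 0" for i
    proof -
      have "(\<Sum>j\<in>UNIV. t $ j) = (\<Sum>j\<in>(UNIV::'i set). t $ i)" using const by (intro sum.cong) auto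
      then show ?thesis using t by (simp add: S_def)
    qed
    then have "t = 0" by (simp add: vec_eq_iff)
    then show False using t by (simp add: S_def)
  qed
  have "compact S" unfolding S_def
    by (intro compact_Int_closed compact_sphere closed_Collect_eq continuous_intros)
  \<comment> \<open>With a single agent no unit vector has zero sum; then \<open>S\<close> is empty
    and \<open>1\<close> serves as a default.\<close>
  have "\<exists>lam>0. \<forall>t\<in>S. lam \<le> D t"
  proof (cases "S = {}")
    case False
    have "continuous_on S D" unfolding D_def by (intro continuous_intros)
    then obtain s where "s \<in> S" "\<forall>t\<in>S. D s \<le> D t"
      using continuous_attains_inf[OF \<open>compact S\<close> False] by blast
    then show ?thesis using pos by blast
  qed (auto intro: exI[of _ 1])
  then obtain lam where lam: "lam > 0" "\<And>t. t \<in> S \<Longrightarrow> lam \<le> D t" by blast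
  have "lam * (norm t)\<^sup>2 \<le> D t" if t: "(\<Sum>i\<in>UNIV. t $ i) = 0" for t
  proof (cases "t = 0")
    case False
    define s where "s = (1 / norm t) *\<^sub>R t"
    have "s \<in> S" using t False by (simp add: S_def s_def flip: sum_divide_distrib)
    then have "lam * (norm t)\<^sup>2 \<le> D s * (norm t)\<^sup>2" using lam(2) by (simp add: mult_right_mono)
    also have "\<dots> = D (norm t *\<^sub>R s)"
      by (simp add: D_def sum_distrib_right power_mult_distrib flip: right_diff_distrib)
        (simp add: mult_ac)
    also have "norm t *\<^sub>R s = t" using False by (simp add: s_def)
    finally show ?thesis .
  qed (simp add: D0)
  then show ?thesis using that lam(1) by (simp add: D_def)
qed

text \<open>Composed with \<open>consensus\<close> this is the orthogonal projection onto the
  consensus subspace, so \<open>x - consensus (estimate_mean x)\<close> is the disagreement part of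
  \<open>x\<close>.\<close>

definition estimate_mean :: "real^('i::finite \<times> 'n::finite) \<Rightarrow> real^'n" where
  "estimate_mean x = (1 / real CARD('i)) *\<^sub>R (\<Sum>i\<in>UNIV. estimate x i)"

lemma laplacian_nth:
  "((mat 1 - kronecker W (mat 1)) *v x) $ (i, c) = x $ (i, c) - (\<Sum>j\<in>UNIV. W $ i $ j * x $ (j, c))"
proof -
  have "(kronecker W (mat 1) *v x) $ (i, c) =
      (\<Sum>j\<in>UNIV. \<Sum>c'\<in>UNIV. if c' = c then W $ i $ j * x $ (j, c) else 0)"
    unfolding matrix_vector_mult_def kronecker_def mat_def
    unfolding vec_lambda_beta sum.cartesian_product UNIV_Times_UNIV
    by (intro sum.cong) auto
  then show ?thesis by (simp add: matrix_vector_mult_diff_rdistrib)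
qed

lemma laplacian_consensus:
  assumes "graph_weight_matrix E W"
  shows "(mat 1 - kronecker W (mat 1)) *v consensus y = 0"
  using graph_weight_matrix_row_sum[OF assms]
  by (auto simp: vec_eq_iff laplacian_nth simp flip: sum_distrib_right)

lemma sum_laplacian:
  assumes "graph_weight_matrix E W"
  shows "(\<Sum>i\<in>UNIV. ((mat 1 - kronecker W (mat 1)) *v x) $ (i, c)) = 0"
proof -
  have "(\<Sum>i\<in>UNIV. \<Sum>j\<in>UNIV. W $ i $ j * x $ (j, c)) = (\<Sum>j\<in>UNIV. x $ (j, c))"
    by (subst sum.swap, subst graph_weight_matrix_sym[OF assms])
      (simp add: graph_weight_matrix_row_sum[OF assms] flip: sum_distrib_right)
  then show ?thesis by (simp add: laplacian_nth sum_subtractf)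
qed

text \<open>The Kronecker factor \<open>mat 1\<close> makes the Laplacian act on each strategy
  coordinate separately, so the scalar Dirichlet form applies coordinate by coordinate.\<close>

lemma inner_laplacian:
  assumes "graph_weight_matrix E W"
  shows "inner ((mat 1 - kronecker W (mat 1)) *v x) x =
    (\<Sum>c\<in>UNIV. \<Sum>i\<in>UNIV. \<Sum>j\<in>UNIV. W $ i $ j * (x $ (i, c) - x $ (j, c))\<^sup>2) / 2"
proof -
  have "inner ((mat 1 - kronecker W (mat 1)) *v x) x =
      (\<Sum>c\<in>UNIV. \<Sum>i\<in>UNIV. (x $ (i, c) - (\<Sum>j\<in>UNIV. W $ i $ j * x $ (j, c))) * x $ (i, c))"
    unfolding inner_estimates by (subst sum.swap) (simp add: inner_vec_def laplacian_nth)
  then show ?thesis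
    by (simp add: dirichlet_form[OF assms, of "\<lambda>i. x $ (i, c)" for c] sum_divide_distrib)
qed

lemma inner_laplacian_nonneg:
  assumes "graph_weight_matrix E W"
  shows "inner ((mat 1 - kronecker W (mat 1)) *v x) x \<ge> 0"
  unfolding inner_laplacian[OF assms]
  by (intro divide_nonneg_nonneg sum_nonneg mult_nonneg_nonneg graph_weight_matrix_nonneg[OF assms]) auto

text \<open>In each coordinate the disagreement sums to zero over the agents, so the scalar gap
  applies, and differences between agents do not see the subtracted mean. The constant is halved
  because of the factor in the Dirichlet form.\<close>

lemma laplacian_gap:
  fixes W :: "real^'i::finite^'i"
  assumes E: "connected_undirected_graph E" and W: "graph_weight_matrix E W"
  obtains lam where "lam > 0" and "\<And>x :: real^('i \<times> 'n::finite).
    lam * (norm (x - consensus (estimate_mean x)))\<^sup>2 \<le> inner ((mat 1 - kronecker W (mat 1)) *v x) x"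
proof -
  obtain lam where lam: "lam > 0" and gap: "\<And>t :: real^'i. (\<Sum>i\<in>UNIV. t $ i) = 0 \<Longrightarrow>
    lam * (norm t)\<^sup>2 \<le> (\<Sum>i\<in>UNIV. \<Sum>j\<in>UNIV. W $ i $ j * (t $ i - t $ j)\<^sup>2)"
    using dirichlet_form_gap[OF E W] by blast
  have "lam / 2 * (norm (x - consensus (estimate_mean x)))\<^sup>2 \<le>
      inner ((mat 1 - kronecker W (mat 1)) *v x) x" for x :: "real^('i \<times> 'n)"
  proof -
    define e where "e = x - consensus (estimate_mean x)"
    define t where "t c = (\<chi> i. e $ (i, c))" for c
    have t0: "(\<Sum>i\<in>UNIV. t c $ i) = 0" for c
      by (simp add: t_def e_def estimate_mean_def sum_subtractf)
    have "(norm e)\<^sup>2 = (\<Sum>c\<in>UNIV. (norm (t c))\<^sup>2)"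
      unfolding power2_norm_eq_inner inner_estimates
      by (subst inner_vec_def, subst sum.swap) (simp add: t_def inner_vec_def)
    then have "lam * (norm e)\<^sup>2 \<le>
        (\<Sum>c\<in>UNIV. \<Sum>i\<in>UNIV. \<Sum>j\<in>UNIV. W $ i $ j * (t c $ i - t c $ j)\<^sup>2)"
      by (simp add: sum_distrib_left sum_mono gap[OF t0])
    then show ?thesis
      unfolding inner_laplacian[OF W] by (simp add: t_def e_def)
  qed
  then show ?thesis using that[of "lam / 2"] lam by simp
qed

section \<open>Zeros of \<open>A_alpha\<close>\<close>

text \<open>The set constrains only own strategies. An estimate of another agent's coordinate moves
  freely in both directions, which forces the normal to vanish there.\<close>

lemma normal_cone_extended_strategies_support:
  assumes v: "v \<in> normal_cone (extended_strategies owner X) x" and i: "owner c \<noteq> i"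
  shows "v $ (i, c) = 0"
proof -
  have "s * v $ (i, c) \<le> 0" for s
  proof -
    have "selection_matrix owner *v (x + axis (i, c) s) = selection_matrix owner *v x"
      using i by (auto simp: vec_eq_iff axis_def)
    moreover have "x \<in> extended_strategies owner X"
      and le: "\<And>y. y \<in> extended_strategies owner X \<Longrightarrow> inner v (y - x) \<le> 0"
      using v by (auto simp: normal_cone_def split: if_splits)
    ultimately have "x + axis (i, c) s \<in> extended_strategies owner X"
      by (simp add: extended_strategies_def)
    from le[OF this] show ?thesis by (simp add: inner_axis mult.commute)
  qed
  from this[of 1] this[of "-1"] show ?thesis by simp
qed

text \<open>Summing an inclusion \<open>0 \<in> A_alpha x\<close> over the agents cancels the Laplacian, because its
  columns sum to zero; the remaining terms cancel each other, which leaves \<open>x\<close> in the kernel of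
  the Laplacian.\<close>

lemma zer_A_alpha:
  fixes owner :: "'n::finite \<Rightarrow> 'i::finite"
  assumes game: "convex_game owner X f"
    and E: "connected_undirected_graph E" and W: "graph_weight_matrix E W" and \<alpha>: "\<alpha> > 0"
  shows "zer (A_alpha owner X f W \<alpha>) = consensus ` nash_equilibria owner X f"
proof (intro equalityI subsetI)
  let ?S = "selection_matrix owner" and ?L = "mat 1 - kronecker W (mat 1) :: real^('i \<times> 'n)^('i \<times> 'n)"
  fix x :: "real^('i \<times> 'n)" assume "x \<in> consensus ` nash_equilibria owner X f"
  then obtain y where x: "x = consensus y" and "y \<in> nash_equilibria owner X f" by blast
  then obtain u where yX: "y \<in> joint_strategies owner X"
    and u: "\<And>i. block owner i u \<in> partial_subdiff owner f i y"
    and uX: "\<And>y'. y' \<in> joint_strategies owner X \<Longrightarrow> inner u (y' - y) \<ge> 0"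
    using nash_equilibria_iff[OF game] by blast
  have "\<alpha> *\<^sub>R (transpose ?S *v u) + ?L *v x \<in> F_alpha owner f W \<alpha> x"
    using u by (auto simp: F_alpha_def lifted_game_map_def extended_game_map_def x)
  \<comment> \<open>This normal vector cancels the game term, and the Laplacian term vanishes on
    consensus vectors.\<close>
  moreover have "- (\<alpha> *\<^sub>R (transpose ?S *v u)) \<in> normal_cone (extended_strategies owner X) x"
    using yX uX \<alpha>
    by (auto simp: normal_cone_def extended_strategies_def x inner_transpose_mult
        matrix_vector_mult_diff_distrib)
  ultimately have "\<alpha> *\<^sub>R (transpose ?S *v u) + ?L *v x + - (\<alpha> *\<^sub>R (transpose ?S *v u))
      \<in> A_alpha owner X f W \<alpha> x" unfolding A_alpha_def by blast
  then show "x \<in> zer (A_alpha owner X f W \<alpha>)"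
    by (simp add: zer_def x laplacian_consensus[OF W])
next
  let ?S = "selection_matrix owner" and ?L = "mat 1 - kronecker W (mat 1) :: real^('i \<times> 'n)^('i \<times> 'n)"
  fix x :: "real^('i \<times> 'n)" assume "x \<in> zer (A_alpha owner X f W \<alpha>)"
  then obtain u v where u: "u \<in> extended_game_map owner f x"
    and v: "v \<in> normal_cone (extended_strategies owner X) x"
    and eq0: "0 = \<alpha> *\<^sub>R (transpose ?S *v u) + ?L *v x + v"
    by (auto simp: zer_def A_alpha_def F_alpha_def lifted_game_map_def)
  have eq: "\<alpha> * (if owner c = i then u $ c else 0) + (?L *v x) $ (i, c) + v $ (i, c) = 0" for i c
    using arg_cong[OF eq0, of "\<lambda>z. z $ (i, c)"]
    by (simp only: vector_add_component vector_scaleR_component real_scaleR_def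
        transpose_selection_matrix_mult_nth zero_index)
  define r where "r = ?S *v v"
  have v_nth: "v $ (i, c) = (if owner c = i then r $ c else 0)" for i c
    using normal_cone_extended_strategies_support[OF v, of c i] by (auto simp: r_def)
  have r: "r $ c = - \<alpha> * u $ c" for c
  proof -
    have "0 = (\<Sum>i\<in>UNIV. \<alpha> * (if owner c = i then u $ c else 0) + (?L *v x) $ (i, c) + v $ (i, c))"
      by (simp only: eq sum.neutral_const)
    also have "\<dots> = \<alpha> * u $ c + r $ c"
      by (simp add: sum.distrib sum_laplacian[OF W] v_nth flip: sum_distrib_left)
    finally show ?thesis by simp
  qed
  have "?L *v x = 0"
  proof -
    have "(?L *v x) $ (i, c) = 0" for i c using eq[of c i] by (simp add: v_nth r split: if_splits)
    then show ?thesis by (simp add: vec_eq_iff)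
  qed
  \<comment> \<open>The spectral gap bounds the disagreement of a kernel vector by zero, so
    \<open>x\<close> is a consensus vector.\<close>
  moreover obtain lam where "lam > 0"
    "lam * (norm (x - consensus (estimate_mean x)))\<^sup>2 \<le> inner (?L *v x) x"
    using laplacian_gap[OF E W, where 'n = 'n] by metis
  ultimately have "(norm (x - consensus (estimate_mean x)))\<^sup>2 \<le> 0"
    by (simp add: mult_le_0_iff)
  then have x: "x = consensus (estimate_mean x)" by simp
  define y where "y = estimate_mean x"
  have xy: "x = consensus y" using x y_def by simp
  have v': "v = transpose ?S *v r" by (simp add: vec_eq_iff v_nth)
  have r': "r = - \<alpha> *\<^sub>R u" by (simp add: vec_eq_iff r)
  have "y \<in> joint_strategies owner X"
    using v by (simp add: normal_cone_def extended_strategies_def xy split: if_splits)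
  \<comment> \<open>The normal cone inequality is tested at consensus vectors only; on their
    differences \<open>v\<close> acts as \<open>- \<alpha> *\<^sub>R u\<close>.\<close>
  moreover have "inner u (y' - y) \<ge> 0" if "y' \<in> joint_strategies owner X" for y'
  proof -
    have "consensus y' \<in> extended_strategies owner X" using that by (simp add: extended_strategies_def)
    then have "inner v (consensus y' - consensus y) \<le> 0"
      using v by (auto simp: normal_cone_def xy split: if_splits)
    then have "- \<alpha> * inner u (y' - y) \<le> 0"
      by (simp add: v' inner_transpose_mult matrix_vector_mult_diff_distrib r')
    then show ?thesis using \<alpha> by (simp add: zero_le_mult_iff)
  qed
  moreover have "block owner i u \<in> partial_subdiff owner f i y" for i
    using u by (simp add: extended_game_map_def xy)
  ultimately have "y \<in> nash_equilibria owner X f"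
    unfolding nash_equilibria_iff[OF game] by blast
  then show "x \<in> consensus ` nash_equilibria owner X f" using xy by blast
qed

section \<open>Monotonicity of \<open>F_alpha\<close>\<close>

text \<open>The Laplacian only adds its nonnegative quadratic form at \<open>x - y\<close>, so (C4)
  can reuse the parameter at which (C2) is stated.\<close>

lemma restricted_monotone_op_F_alpha:
  assumes W: "graph_weight_matrix E W" and \<alpha>: "\<alpha> > 0"
    and T: "restricted_monotone_op \<Sigma> (lifted_game_map owner f)"
  shows "restricted_monotone_op \<Sigma> (F_alpha owner f W \<alpha>)"
proof -
  let ?L = "mat 1 - kronecker W (mat 1)"
  have "inner (x - y) (u' - v') \<ge> 0"
    if u': "u' \<in> F_alpha owner f W \<alpha> x" and v': "v' \<in> F_alpha owner f W \<alpha> y" and y: "y \<in> \<Sigma>"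
    for x y u' v'
  proof -
    obtain u v where u: "u \<in> lifted_game_map owner f x" "u' = \<alpha> *\<^sub>R u + ?L *v x"
      and v: "v \<in> lifted_game_map owner f y" "v' = \<alpha> *\<^sub>R v + ?L *v y"
      using u' v' unfolding F_alpha_def by blast
    have "inner (x - y) (u - v) \<ge> 0"
      using T u(1) v(1) y by (auto simp: restricted_monotone_op_def op_graph_def)
    moreover have "inner (x - y) (u' - v') =
        \<alpha> * inner (x - y) (u - v) + inner (?L *v (x - y)) (x - y)"
      unfolding u v by (simp add: matrix_vector_mult_diff_distrib algebra_simps inner_commute)
    ultimately show ?thesis using \<alpha> inner_laplacian_nonneg[OF W, of "x - y"] by simp
  qed
  then show ?thesis
    using T by (auto simp: restricted_monotone_op_def op_graph_def)
qed

text \<open>Blocks of elements of the game map can be exchanged independently: splicing the owner's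
  block of \<open>u\<close> into \<open>g z\<close> gives another element of the singleton at
  \<open>z\<close>.\<close>

lemma extended_game_map_single_valued:
  assumes game: "convex_game owner X f" and g: "game_map owner f = (\<lambda>x. {g x})"
    and u: "u \<in> extended_game_map owner f x"
  shows "u $ c = g (estimate x (owner c)) $ c"
proof -
  define i where "i = owner c"
  define z where "z = estimate x i"
  have gz: "g z \<in> game_map owner f z" by (simp add: g)
  define w where "w = with_block owner i u (g z)"
  have "block owner j w = (if j = i then block owner i u else block owner j (g z))" for j
    by (auto simp: w_def with_block_def vec_eq_iff)
  then have "w \<in> game_map owner f z"
    using u gz by (simp add: game_map_def extended_game_map_def z_def)
  then have "w = g z" by (simp add: g)
  then have "w $ c = g z $ c" by simp
  then show ?thesis by (simp add: w_def with_block_def z_def i_def)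
qed

text \<open>This controls the error of replacing the individual estimates by a common point
  \<open>z\<close>. Enlarging to the full vectors of all agents keeps the constant \<open>l\<close>,
  because the squared distances of the estimates to \<open>z\<close> add up to that of
  \<open>x\<close> to \<open>consensus z\<close>.\<close>

lemma norm_own_block_diff_le:
  fixes g :: "real^'n::finite \<Rightarrow> real^'n" and owner :: "'n \<Rightarrow> 'i::finite"
  assumes g: "lipschitz_on l UNIV g"
  shows "norm (\<chi> c. (g (estimate x (owner c)) - g z) $ c) \<le> l * norm (x - consensus z)"
proof -
  let ?h = "\<lambda>i. g (estimate x i) - g z"
  have l: "l \<ge> 0" using g by (rule lipschitz_on_nonneg)
  have "(norm (\<chi> c. ?h (owner c) $ c))\<^sup>2 = (\<Sum>c\<in>UNIV. (?h (owner c) $ c)\<^sup>2)"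
    unfolding power2_norm_eq_inner by (simp add: inner_vec_def power2_eq_square)
  also have "\<dots> \<le> (\<Sum>c\<in>UNIV. \<Sum>i\<in>UNIV. (?h i $ c)\<^sup>2)"
    by (intro sum_mono member_le_sum[where f = "\<lambda>i. (?h i $ c)\<^sup>2" for c]) auto
  also have "\<dots> = (\<Sum>i\<in>UNIV. (norm (?h i))\<^sup>2)"
    unfolding power2_norm_eq_inner by (subst sum.swap) (simp add: inner_vec_def power2_eq_square)
  also have "\<dots> \<le> (\<Sum>i\<in>UNIV. l\<^sup>2 * (norm (estimate x i - z))\<^sup>2)"
  proof (intro sum_mono)
    fix i
    have "norm (?h i) \<le> l * norm (estimate x i - z)"
      using lipschitz_onD[OF g, of "estimate x i" z] by (simp add: dist_norm)
    then show "(norm (?h i))\<^sup>2 \<le> l\<^sup>2 * (norm (estimate x i - z))\<^sup>2"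
      by (metis norm_ge_zero power_mono power_mult_distrib)
  qed
  also have "\<dots> = (l * norm (x - consensus z))\<^sup>2"
  proof -
    have "estimate (x - consensus z) i = estimate x i - z" for i by (simp add: vec_eq_iff)
    then show ?thesis
      by (simp add: power_mult_distrib power2_norm_eq_inner inner_estimates sum_distrib_left)
  qed
  finally show ?thesis by (rule power2_le_imp_le) (simp add: l)
qed

text \<open>With \<open>m\<close> the mean of \<open>x - consensus y\<close> over the agents and \<open>e\<close> the disagreement, the game
  part is bounded from below by \<open>\<mu> \<parallel>m\<parallel>\<^sup>2 - 2 l \<parallel>m\<parallel> \<parallel>e\<parallel> - l \<parallel>e\<parallel>\<^sup>2\<close> and the Laplacian part by
  \<open>lam \<parallel>e\<parallel>\<^sup>2\<close>; the quadratic form is nonnegative for the chosen \<open>\<alpha>\<close>.\<close>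

lemma C4_if_C5:
  fixes owner :: "'n::finite \<Rightarrow> 'i::finite"
  assumes game: "convex_game owner X f"
    and E: "connected_undirected_graph E" and W: "graph_weight_matrix E W"
    and C5: "C5 owner X f"
  shows "C4 owner X f W"
proof -
  let ?S = "selection_matrix owner" and ?L = "mat 1 - kronecker W (mat 1) :: real^('i \<times> 'n)^('i \<times> 'n)"
  obtain \<mu> l where \<mu>: "\<mu> > 0" and l: "l > 0"
    and T: "restricted_strongly_monotone_op \<mu> (nash_equilibria owner X f) (game_map owner f)"
    and "lipschitz_op l (game_map owner f)"
    using C5 by (auto simp: C5_def)
  then obtain g where g: "game_map owner f = (\<lambda>x. {g x})" and lip: "lipschitz_on l UNIV g"
    by (auto simp: lipschitz_op_def)
  have strong: "inner (x - y) (g x - g y) \<ge> \<mu> * (norm (x - y))\<^sup>2"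
    if "y \<in> nash_equilibria owner X f" for x y
    using T that by (auto simp: restricted_strongly_monotone_op_def op_graph_def g)
  obtain lam where lam: "lam > 0" and gap: "\<And>x :: real^('i \<times> 'n).
    lam * (norm (x - consensus (estimate_mean x)))\<^sup>2 \<le> inner (?L *v x) x"
    using laplacian_gap[OF E W] by blast
  \<comment> \<open>This value makes the discriminant vanish: \<open>\<mu>\<close> times the
    quadratic form below becomes the perfect square
    \<open>\<alpha> * (\<mu> * a - l * b)\<^sup>2\<close>.\<close>
  define \<alpha> where "\<alpha> = \<mu> * lam / (l\<^sup>2 + \<mu> * l)"
  have denom: "l\<^sup>2 + \<mu> * l > 0" using \<mu> l by (simp add: add_pos_pos)
  have \<alpha>: "\<alpha> > 0" unfolding \<alpha>_def using \<mu> lam denom by simp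
  have \<alpha>_eq: "\<alpha> * l\<^sup>2 = \<mu> * (lam - \<alpha> * l)"
  proof -
    have "\<alpha> * (l\<^sup>2 + \<mu> * l) = \<mu> * lam" using denom by (simp add: \<alpha>_def)
    then show ?thesis by (simp add: algebra_simps)
  qed
  have quad: "\<alpha> * (\<mu> * a\<^sup>2 - 2 * l * a * b - l * b\<^sup>2) + lam * b\<^sup>2 \<ge> 0" for a b
  proof -
    have "\<mu> * (\<alpha> * (\<mu> * a\<^sup>2 - 2 * l * a * b - l * b\<^sup>2) + lam * b\<^sup>2) =
        \<alpha> * (\<mu> * a)\<^sup>2 - 2 * \<alpha> * l * \<mu> * a * b + \<mu> * (lam - \<alpha> * l) * b\<^sup>2"
      by (simp add: power2_eq_square algebra_simps)
    also have "\<dots> = \<alpha> * (\<mu> * a - l * b)\<^sup>2"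
      by (subst \<alpha>_eq[symmetric]) (simp add: power2_eq_square algebra_simps)
    also have "\<dots> \<ge> 0" using \<alpha> by simp
    finally show ?thesis using \<mu> by (simp add: zero_le_mult_iff)
  qed
  have "inner (x - consensus y) (\<alpha> *\<^sub>R (transpose ?S *v u) + ?L *v x
      - (\<alpha> *\<^sub>R (transpose ?S *v v) + ?L *v consensus y)) \<ge> 0"
    if y: "y \<in> nash_equilibria owner X f" and u: "u \<in> extended_game_map owner f x"
      and v: "v \<in> extended_game_map owner f (consensus y)" for x y u v
  proof -
    define d where "d = x - consensus y"
    define m where "m = estimate_mean d"
    define e where "e = d - consensus m"
    \<comment> \<open>The difference of game values is split at \<open>y + m\<close>, the mean of
      the estimates in \<open>x\<close>: strong monotonicity handles the part from \<open>y\<close>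
      to \<open>y + m\<close>, and \<open>h\<close> is the error due to disagreement.\<close>
    define h where "h = (\<chi> c. (g (estimate x (owner c)) - g (y + m)) $ c)"
    have "v = g y"
      using extended_game_map_single_valued[OF game g v] by (simp add: vec_eq_iff)
    then have uv: "u - v = (g (y + m) - g y) + h"
      using extended_game_map_single_valued[OF game g u] by (simp add: vec_eq_iff h_def)
    have Sd: "?S *v d = m + ?S *v e" by (simp add: e_def matrix_vector_mult_diff_distrib)
    have h: "norm h \<le> l * norm e"
    proof -
      have "x - consensus (y + m) = e" by (simp add: e_def d_def vec_eq_iff)
      then show ?thesis using norm_own_block_diff_le[OF lip, of x owner "y + m"] by (simp add: h_def)
    qed
    have Se: "norm (?S *v e) \<le> norm e" by (rule norm_selection_matrix_mult_le)
    have gm: "norm (g (y + m) - g y) \<le> l * norm m"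
      using lipschitz_onD[OF lip, of "y + m" y] by (simp add: dist_norm)
    \<comment> \<open>Four products arise: one strongly monotone, two mixed ones costing
      \<open>l * norm m * norm e\<close> each, and one quadratic in \<open>e\<close>.\<close>
    have "inner (g (y + m) - g y) m \<ge> \<mu> * (norm m)\<^sup>2"
      using strong[OF y, of "y + m"] by (simp add: inner_commute)
    moreover have "\<bar>inner (g (y + m) - g y) (?S *v e)\<bar> \<le> l * norm m * norm e"
      by (rule order_trans[OF Cauchy_Schwarz_ineq2]) (use gm Se l in \<open>intro mult_mono; simp\<close>)
    moreover have "\<bar>inner h m\<bar> \<le> l * norm e * norm m"
      by (rule order_trans[OF Cauchy_Schwarz_ineq2]) (use h in \<open>intro mult_right_mono; simp\<close>)
    moreover have "\<bar>inner h (?S *v e)\<bar> \<le> l * norm e * norm e"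
      by (rule order_trans[OF Cauchy_Schwarz_ineq2]) (use h Se l in \<open>intro mult_mono; simp\<close>)
    ultimately have "inner (u - v) (?S *v d) \<ge>
        \<mu> * (norm m)\<^sup>2 - 2 * l * norm m * norm e - l * (norm e)\<^sup>2"
      unfolding uv Sd inner_add_left inner_add_right
      by (simp add: power2_eq_square mult_ac abs_le_iff)
    then have "\<alpha> * inner (u - v) (?S *v d) \<ge>
        \<alpha> * (\<mu> * (norm m)\<^sup>2 - 2 * l * norm m * norm e - l * (norm e)\<^sup>2)"
      using \<alpha> by simp
    moreover have "inner (?L *v d) d \<ge> lam * (norm e)\<^sup>2" using gap[of d] by (simp add: e_def m_def)
    ultimately have "\<alpha> * inner (u - v) (?S *v d) + inner (?L *v d) d \<ge> 0"
      using quad[of "norm m" "norm e"] by linarith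
    moreover have "inner d (\<alpha> *\<^sub>R (transpose ?S *v u) + ?L *v x
        - (\<alpha> *\<^sub>R (transpose ?S *v v) + ?L *v consensus y)) =
        \<alpha> * inner (transpose ?S *v (u - v)) d + inner (?L *v d) d"
      unfolding d_def by (simp add: matrix_vector_mult_diff_distrib algebra_simps inner_commute)
    ultimately show ?thesis by (simp add: inner_transpose_mult d_def)
  qed
  then have "restricted_monotone_op (consensus ` nash_equilibria owner X f) (F_alpha owner f W \<alpha>)"
    using T by (auto simp: restricted_monotone_op_def restricted_strongly_monotone_op_def
        op_graph_def F_alpha_def lifted_game_map_def)
  then show ?thesis
    using \<alpha> by (auto simp: C4_def zer_A_alpha[OF game E W])
qed

text \<open>For \<open>\<alpha> = 1\<close> the operator is the lifted game map plus a monotone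
  linear map, so the sum lemma applies directly; convexity of the costs supplies nonempty
  values.\<close>

lemma C3_if_C1:
  assumes game: "convex_game owner X f" and W: "graph_weight_matrix E W" and C1: "C1 owner f"
  shows "C3 owner f W"
proof -
  have "lifted_game_map owner f x \<noteq> {}" for x
    using extended_game_map_nonempty[OF game] by (auto simp: lifted_game_map_def)
  then have "maximally_monotone_op (F_alpha owner f W 1)"
    using maximally_monotone_op_add_linear[OF C1[unfolded C1_def] _ matrix_vector_mul_linear
        inner_laplacian_nonneg[OF W]]
    by (simp add: F_alpha_def[abs_def])
  then show ?thesis by (auto simp: C3_def intro!: exI[of _ 1])
qed

section \<open>Implications among the conditions on the game mapping\<close>

lemma C6E:
  assumes "C6 owner f"
  obtains \<mu> l g where "\<mu> > 0" "l > 0" "game_map owner f = (\<lambda>x. {g x})" "lipschitz_on l UNIV g"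
    "\<And>x y. inner (g x - g y) (x - y) \<ge> \<mu> * (norm (x - y))\<^sup>2"
  using assms by (auto simp: C6_def lipschitz_op_def strongly_monotone_op_def op_graph_def)

lemma C5_if_C6:
  assumes "nash_equilibria owner X f \<noteq> {}" "C6 owner f"
  shows "C5 owner X f"
proof -
  have "restricted_strongly_monotone_op \<mu> (nash_equilibria owner X f) (game_map owner f)"
    if "strongly_monotone_op \<mu> (game_map owner f)" for \<mu>
    unfolding restricted_strongly_monotone_op_def
    using assms(1) that[unfolded strongly_monotone_op_def] by (subst inner_commute) blast
  then show ?thesis using assms(2) unfolding C5_def C6_def by blast
qed

text \<open>Strong monotonicity gives hypomonotonicity with constant zero and, by Cauchy-Schwarz, an
  inverse Lipschitz constant \<open>1 / \<mu>\<close>; their product is zero.\<close>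

lemma C7_if_C6:
  assumes "C6 owner f"
  shows "C7 owner f"
proof -
  obtain \<mu> l g where \<mu>: "\<mu> > 0" and l: "l > 0" and g: "game_map owner f = (\<lambda>x. {g x})"
    and lip: "lipschitz_on l UNIV g" and strong: "\<And>x y. inner (g x - g y) (x - y) \<ge> \<mu> * (norm (x - y))\<^sup>2"
    using assms by (rule C6E) blast
  have inv: "norm (x - y) \<le> 1 / \<mu> * norm (g x - g y)" for x y
  proof (cases "x = y")
    case False
    have "\<mu> * norm (x - y) * norm (x - y) \<le> norm (g x - g y) * norm (x - y)"
      using strong[of x y] norm_cauchy_schwarz[of "g x - g y" "x - y"]
      by (simp add: power2_eq_square mult.assoc)
    then show ?thesis using False \<mu> by (simp add: field_simps)
  qed simp
  have "inner (g x - g y) (x - y) \<ge> 0" for x y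
    by (rule order_trans[OF _ strong]) (use \<mu> in simp)
  then have "hypomonotone_op 0 (game_map owner f)"
    by (simp add: hypomonotone_op_def op_graph_def g)
  moreover have "inverse_lipschitz_op (1 / \<mu>) (game_map owner f)"
    unfolding inverse_lipschitz_op_def using g inv by blast
  moreover have "lipschitz_op l (game_map owner f)"
    unfolding lipschitz_op_def using g lip by blast
  ultimately show ?thesis unfolding C7_def using l \<mu>
    by (intro exI[of _ 0] exI[of _ l] exI[of _ "1 / \<mu>"] conjI) auto
qed

lemma C8_if_C6:
  assumes "C6 owner f"
  shows "C8 owner f"
proof -
  obtain \<mu> l g where \<mu>: "\<mu> > 0" and l: "l > 0" and g: "game_map owner f = (\<lambda>x. {g x})"
    and lip: "lipschitz_on l UNIV g" and strong: "\<And>x y. inner (g x - g y) (x - y) \<ge> \<mu> * (norm (x - y))\<^sup>2"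
    using assms by (rule C6E) blast
  have "inner (g x - g y) (x - y) > 0" if "x \<noteq> y" for x y
    by (rule less_le_trans[OF _ strong]) (use \<mu> that in simp)
  then have "strictly_monotone_op (game_map owner f)"
    by (simp add: strictly_monotone_op_def op_graph_def g)
  then show ?thesis using l g lip by (auto simp: C8_def lipschitz_op_def)
qed

text \<open>The Lipschitz bound followed by strong monotonicity yields cocoercivity with constant
  \<open>\<mu> / l\<^sup>2\<close>, so the witness is its reciprocal.\<close>

lemma C9_if_C6:
  assumes "C6 owner f"
  shows "C9 owner f"
proof -
  obtain \<mu> l g where \<mu>: "\<mu> > 0" and l: "l > 0" and g: "game_map owner f = (\<lambda>x. {g x})"
    and lip: "lipschitz_on l UNIV g" and strong: "\<And>x y. inner (g x - g y) (x - y) \<ge> \<mu> * (norm (x - y))\<^sup>2"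
    using assms by (rule C6E) blast
  have "1 / (l\<^sup>2 / \<mu>) * (norm (g x - g y))\<^sup>2 \<le> inner (x - y) (g x - g y)" for x y
  proof -
    have "norm (g x - g y) \<le> l * norm (x - y)"
      using lipschitz_onD[OF lip, of x y] by (simp add: dist_norm)
    then have "(norm (g x - g y))\<^sup>2 \<le> (l * norm (x - y))\<^sup>2" by (simp add: power_mono)
    then have "1 / (l\<^sup>2 / \<mu>) * (norm (g x - g y))\<^sup>2 \<le> 1 / (l\<^sup>2 / \<mu>) * (l * norm (x - y))\<^sup>2"
      using \<mu> by (intro mult_left_mono) auto
    also have "\<dots> = \<mu> * (norm (x - y))\<^sup>2" using l by (simp add: power_mult_distrib)
    also have "\<dots> \<le> inner (x - y) (g x - g y)" using strong by (simp add: inner_commute)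
    finally show ?thesis .
  qed
  then have "cocoercive_op (1 / (l\<^sup>2 / \<mu>)) (game_map owner f)"
    unfolding cocoercive_op_def using g by blast
  moreover have "l\<^sup>2 / \<mu> > 0" using \<mu> l by simp
  ultimately show ?thesis unfolding C9_def by blast
qed

lemma C10_if_C8:
  assumes "C8 owner f"
  shows "C10 owner f"
proof -
  obtain l g where l: "l > 0" "lipschitz_on l UNIV g" and g: "game_map owner f = (\<lambda>x. {g x})"
    and "strictly_monotone_op (game_map owner f)"
    using assms by (auto simp: C8_def lipschitz_op_def)
  then have pos: "x \<noteq> y \<Longrightarrow> inner (g x - g y) (x - y) > 0" for x y
    by (simp add: strictly_monotone_op_def op_graph_def)
  have "inner (g x - g y) (x - y) \<ge> 0" for x y
    using pos[of x y] by (cases "x = y") auto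
  then have "monotone_op (game_map owner f)" by (simp add: monotone_op_def op_graph_def g)
  then show ?thesis using l g by (auto simp: C10_def lipschitz_op_def)
qed

text \<open>Cauchy-Schwarz turns cocoercivity into the Lipschitz bound with the same
  \<open>l\<close> after cancelling one norm.\<close>

lemma C10_if_C9:
  assumes "C9 owner f"
  shows "C10 owner f"
proof -
  obtain l g where l: "l > 0" and g: "game_map owner f = (\<lambda>x. {g x})"
    and coco: "\<And>x y. inner (x - y) (g x - g y) \<ge> 1 / l * (norm (g x - g y))\<^sup>2"
    using assms by (auto simp: C9_def cocoercive_op_def)
  have "inner (g x - g y) (x - y) \<ge> 0" for x y
    by (subst inner_commute, rule order_trans[OF _ coco]) (use l in simp)
  then have "monotone_op (game_map owner f)" by (simp add: monotone_op_def op_graph_def g)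
  moreover have "lipschitz_on l UNIV g"
  proof (rule lipschitz_onI)
    fix x y
    have "1 / l * (norm (g x - g y))\<^sup>2 \<le> norm (x - y) * norm (g x - g y)"
      using coco norm_cauchy_schwarz by (rule order_trans)
    then have "norm (g x - g y) * norm (g x - g y) \<le> l * norm (x - y) * norm (g x - g y)"
      using l by (simp add: field_simps power2_eq_square)
    then show "dist (g x) (g y) \<le> l * dist x y"
      using l by (cases "g x = g y") (simp_all add: dist_norm)
  qed (use l in simp)
  ultimately show ?thesis using l g by (auto simp: C10_def lipschitz_op_def)
qed

theorem proposition1:
  fixes owner :: "'n::finite \<Rightarrow> 'i::finite"
    and X :: "'i \<Rightarrow> (real^'n) set"
    and f :: "'i \<Rightarrow> real^'n \<Rightarrow> real"
    and E :: "('i \<times> 'i) set"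
    and W :: "real^'i^'i"
    and \<alpha> :: real
  assumes "convex_game owner X f"
    and "nash_equilibria owner X f \<noteq> {}"
    and "connected_undirected_graph E"
    and "graph_weight_matrix E W"
    and "\<alpha> > 0"
  shows "(C1 owner f \<longrightarrow> C2 owner X f W \<alpha>) \<and>
         (C1 owner f \<longrightarrow> C3 owner f W) \<and>
         (C2 owner X f W \<alpha> \<longrightarrow> C4 owner X f W) \<and>
         (C3 owner f W \<longrightarrow> C4 owner X f W) \<and>
         (C5 owner X f \<longrightarrow> C4 owner X f W) \<and>
         (C6 owner f \<longrightarrow> C5 owner X f) \<and>
         (C6 owner f \<longrightarrow> C7 owner f) \<and>
         (C6 owner f \<longrightarrow> C8 owner f) \<and>
         (C6 owner f \<longrightarrow> C9 owner f) \<and>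
         (C8 owner f \<longrightarrow> C10 owner f) \<and>
         (C9 owner f \<longrightarrow> C10 owner f)"
proof -
  have zer: "zer (A_alpha owner X f W a) = consensus ` nash_equilibria owner X f" if "a > 0" for a
    using zer_A_alpha[OF assms(1,3,4) that] .
  \<comment> \<open>Nonemptiness is stated for every positive parameter, since the witness of (C3)
    may differ from the fixed \<open>\<alpha>\<close>.\<close>
  have ne: "zer (A_alpha owner X f W a) \<noteq> {}" if "a > 0" for a
    using zer[OF that] assms(2) by simp
  have "C1 owner f \<longrightarrow> C2 owner X f W \<alpha>"
    using ne[OF \<open>\<alpha> > 0\<close>] by (auto simp: C1_def C2_def maximally_monotone_op_def
        intro: restricted_monotone_op_if_monotone_op)
  moreover have "C2 owner X f W \<alpha> \<longrightarrow> C4 owner X f W"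
    using \<open>\<alpha> > 0\<close> by (auto simp: C2_def C4_def intro: restricted_monotone_op_F_alpha[OF assms(4)])
  moreover have "C3 owner f W \<longrightarrow> C4 owner X f W"
    unfolding C3_def C4_def maximally_monotone_op_def
    using ne restricted_monotone_op_if_monotone_op by blast
  ultimately show ?thesis
    using C3_if_C1[OF assms(1,4)] C4_if_C5[OF assms(1,3,4)] C5_if_C6[OF assms(2)]
      C7_if_C6 C8_if_C6 C9_if_C6 C10_if_C8 C10_if_C9 by blast
qed

end
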